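(* Let $\sum_{n=1}^\infty a_nn^{-s}$ and $\sum_{n=1}^\infty b_nn^{-s}$ be Dirichlet series with real coefficients and nonnegative partial sums ($\sum_{n\le y}a_n\ge0$ and $\sum_{n\le y}b_n\ge0$ for all $y\ge1$). Let $0<r<t$ be real numbers such that $\sum a_nn^{-r}$ and $\sum b_nn^{-t}$ lie in the respective regions of absolute convergence, i.e. converge absolutely. Then $$\int_1^\infty\left(\int_1^x\sqrt{\sum_{n\le y}a_n\sum_{n\le x/y}b_n}\;\frac{dy}{y}\right)^2\frac{dx}{x^{t+1}}\le\frac{1}{t(t-r)r}\sum_{n=1}^\infty a_nn^{-r}\sum_{n=1}^\infty b_nn^{-t}.$$ *)

theory Defs
  imports "HOL-Analysis.Analysis"
begin

definition coeff_sum :: "(nat \<Rightarrow> real) \<Rightarrow> real \<Rightarrow> real" where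
  "coeff_sum a y = (\<Sum>n | 1 \<le> n \<and> real n \<le> y. a n)"

text \<open>A Dirichlet series is indexed by \<open>n \<ge> 1\<close>, so its \<open>k\<close>-th term belongs to \<open>n = Suc k\<close>
  and the value \<open>a 0\<close> is never used.\<close>

definition dirichlet_term :: "(nat \<Rightarrow> real) \<Rightarrow> real \<Rightarrow> nat \<Rightarrow> real" where
  "dirichlet_term a s k = a (Suc k) * real (Suc k) powr (- s)"

definition dirichlet_abs_conv :: "(nat \<Rightarrow> real) \<Rightarrow> real \<Rightarrow> bool" where
  "dirichlet_abs_conv a s \<longleftrightarrow> summable (\<lambda>k. \<bar>dirichlet_term a s k\<bar>)"

definition dirichlet_series :: "(nat \<Rightarrow> real) \<Rightarrow> real \<Rightarrow> real" where
  "dirichlet_series a s = (\<Sum>k. dirichlet_term a s k)"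

definition inner_integrand :: "(nat \<Rightarrow> real) \<Rightarrow> (nat \<Rightarrow> real) \<Rightarrow> real \<Rightarrow> real \<Rightarrow> real" where
  "inner_integrand a b x y = sqrt (coeff_sum a y * coeff_sum b (x / y)) / y"

definition outer_integrand :: "(nat \<Rightarrow> real) \<Rightarrow> (nat \<Rightarrow> real) \<Rightarrow> real \<Rightarrow> real \<Rightarrow> real" where
  "outer_integrand a b t x = (LBINT y:{1..x}. inner_integrand a b x y)\<^sup>2 / x powr (t + 1)"

end

theory Submission
  imports Defs
begin

text \<open>Write the inner integrand as \<open>y powr (- p / 2)\<close> times
  \<open>sqrt (A y * B (x / y) * y powr p)\<close>, with respect to the measure \<open>dy / y\<close> and with \<open>p = t - r\<close>,
  where \<open>A\<close> and \<open>B\<close> are the partial sums. The Cauchy-Schwarz inequality bounds the squared inner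
  integral by \<open>1 / p\<close> times a multiplicative convolution. Integrating against
  \<open>x powr (- t - 1)\<close> and substituting \<open>x = y * z\<close>, the right-hand side splits into the product of
  the integrals of \<open>A y * y powr (- r - 1)\<close> and \<open>B z * z powr (- t - 1)\<close>, which by partial
  summation are the Dirichlet series divided by \<open>r\<close> and \<open>t\<close>.\<close>

lemma coeff_sum_conv_floor: "coeff_sum a y = (\<Sum>n=1..nat \<lfloor>y\<rfloor>. a n)"
proof -
  have "real n \<le> y \<longleftrightarrow> n \<le> nat \<lfloor>y\<rfloor>" if "1 \<le> n" for n
    using that by linarith
  then show ?thesis
    unfolding coeff_sum_def by (intro sum.cong) auto
qed

text \<open>There is no index below 1. This carries nonnegativity of the partial sums from
  \<open>y \<ge> 1\<close> to every real \<open>y\<close>, and lets the integrals below run over the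
  whole line.\<close>

lemma coeff_sum_less_1: "y < 1 \<Longrightarrow> coeff_sum a y = 0"
  unfolding coeff_sum_def by (rule sum.neutral) auto

lemma coeff_sum_measurable [measurable]: "coeff_sum a \<in> borel_measurable borel"
proof -
  have "(\<lambda>y. (\<lambda>i. \<Sum>n=1..nat i. a n) \<lfloor>y::real\<rfloor>) \<in> borel_measurable borel"
    by (rule measurable_compose[OF measurable_real_floor]) simp
  then show ?thesis
    by (simp add: coeff_sum_conv_floor[abs_def])
qed

text \<open>Partial sums of signed coefficients need not be monotone, so the majorant takes absolute
  values of the coefficients. It bounds the inner integrand on a compact interval.\<close>

lemma abs_coeff_sum_le:
  assumes "y \<le> x"
  shows "\<bar>coeff_sum a y\<bar> \<le> coeff_sum (\<lambda>n. \<bar>a n\<bar>) x"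
proof -
  have "\<bar>coeff_sum a y\<bar> \<le> (\<Sum>n=1..nat \<lfloor>y\<rfloor>. \<bar>a n\<bar>)"
    unfolding coeff_sum_conv_floor by (rule sum_abs)
  also have "\<dots> \<le> (\<Sum>n=1..nat \<lfloor>x\<rfloor>. \<bar>a n\<bar>)"
    using assms by (intro sum_mono2) (auto intro: order_trans nat_mono floor_mono)
  finally show ?thesis
    unfolding coeff_sum_conv_floor .
qed

lemma has_bochner_integral_powr_atLeast:
  fixes c s :: real
  assumes "c > 0" "s > 0"
  shows "has_bochner_integral lborel (\<lambda>y. indicator {c..} y * y powr (- s - 1)) (c powr (- s) / s)"
proof (rule has_bochner_integral_nn_integral)
  have "(\<integral>\<^sup>+ y. ennreal (y powr (- s - 1)) * indicator {c..} y \<partial>lborel)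
      = ennreal (0 - (- (c powr (- s) / s)))"
  proof (rule nn_integral_FTC_atLeast)
    show "((\<lambda>y. - (y powr (- s) / s)) has_real_derivative y powr (- s - 1)) (at y)" if "c \<le> y" for y
      using that assms by (auto intro!: derivative_eq_intros simp: field_simps)
    have "((\<lambda>y. y powr (- s)) \<longlongrightarrow> 0) at_top"
      using assms by (intro tendsto_neg_powr filterlim_ident) auto
    then show "((\<lambda>y. - (y powr (- s) / s)) \<longlongrightarrow> 0) at_top"
      using tendsto_minus[OF tendsto_divide_zero[of _ _ s]] by fastforce
  qed auto
  then show "(\<integral>\<^sup>+ y. ennreal (indicator {c..} y * y powr (- s - 1)) \<partial>lborel) = ennreal (c powr (- s) / s)"
    by (simp add: ennreal_mult' ennreal_indicator mult.commute)
qed (use assms in auto)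

text \<open>At each \<open>y\<close> only finitely many indicators are nonzero. Written this way,
  partial summation becomes termwise integration of a series.\<close>

lemma sums_coeff_sum:
  "(\<lambda>k. a (Suc k) * indicator {real (Suc k)..} y) sums coeff_sum a y"
proof -
  have "(\<lambda>k. a (Suc k) * indicator {real (Suc k)..} y)
      sums (\<Sum>k<nat \<lfloor>y\<rfloor>. a (Suc k) * indicator {real (Suc k)..} y)"
    by (rule sums_finite) (auto simp: indicator_def le_nat_floor not_less, linarith)
  also have "(\<Sum>k<nat \<lfloor>y\<rfloor>. a (Suc k) * indicator {real (Suc k)..} y) = (\<Sum>k<nat \<lfloor>y\<rfloor>. a (Suc k))"
    by (rule sum.cong) (auto simp: indicator_def, linarith)
  also have "\<dots> = coeff_sum a y"
    unfolding coeff_sum_conv_floor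
    by (simp add: sum.shift_bounds_Suc_ivl atLeast0LessThan sum.atLeast1_atMost_eq)
  finally show ?thesis .
qed

text \<open>The coefficient with index n is counted exactly for \<open>y \<ge> n\<close>, and
  integrating \<open>y powr (- s - 1)\<close> over that ray gives \<open>n powr (- s) / s\<close>.
  Summing over n yields the series divided by \<open>s\<close>.\<close>

lemma has_bochner_integral_coeff_sum:
  assumes s: "s > 0" and conv: "dirichlet_abs_conv a s"
  shows "has_bochner_integral lborel (\<lambda>y. coeff_sum a y * y powr (- s - 1)) (dirichlet_series a s / s)"
proof -
  define f where "f k y = a (Suc k) * (indicator {real (Suc k)..} y * y powr (- s - 1))" for k y
  have f_integral: "has_bochner_integral lborel (f k) (dirichlet_term a s k / s)" for k
    using has_bochner_integral_mult_right[OF has_bochner_integral_powr_atLeast[of "real (Suc k)" s], of "a (Suc k)"] s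
    unfolding f_def[abs_def] dirichlet_term_def by simp
  have "has_bochner_integral lborel (\<lambda>y. \<bar>a (Suc k)\<bar> * (indicator {real (Suc k)..} y * y powr (- s - 1)))
      (\<bar>a (Suc k)\<bar> * (real (Suc k) powr (- s) / s))" for k
    using has_bochner_integral_powr_atLeast[of "real (Suc k)" s] s
    by (intro has_bochner_integral_mult_right) auto
  moreover have "(\<lambda>y. norm (f k y)) = (\<lambda>y. \<bar>a (Suc k)\<bar> * (indicator {real (Suc k)..} y * y powr (- s - 1)))" for k
    by (auto simp: f_def abs_mult)
  ultimately have "has_bochner_integral lborel (\<lambda>y. norm (f k y)) (\<bar>dirichlet_term a s k\<bar> / s)" for k
    by (simp add: dirichlet_term_def abs_mult del: of_nat_Suc)
  then have norm_f: "(\<integral>y. norm (f k y) \<partial>lborel) = \<bar>dirichlet_term a s k\<bar> / s" for k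
    by (rule has_bochner_integral_integral_eq)
  have f_sums: "(\<lambda>k. f k y) sums (coeff_sum a y * y powr (- s - 1))" for y
    using sums_mult2[OF sums_coeff_sum[of a y], of "y powr (- s - 1)"] by (simp add: f_def mult.assoc)
  \<comment> \<open>For fixed \<open>y\<close> this is again a finite sum, now with coefficients
    \<open>\<bar>a n\<bar>\<close>.\<close>
  have f_abs_summable: "summable (\<lambda>k. norm (f k y))" for y
    using sums_mult2[OF sums_coeff_sum[of "\<lambda>n. \<bar>a n\<bar>" y], of "y powr (- s - 1)"]
    by (auto simp: f_def abs_mult mult.assoc dest!: sums_summable)
  \<comment> \<open>Absolute convergence at \<open>s\<close> is what permits exchanging sum and
    integral for signed coefficients.\<close>
  have norms_summable: "summable (\<lambda>k. \<integral>y. norm (f k y) \<partial>lborel)"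
    using conv unfolding norm_f dirichlet_abs_conv_def by (rule summable_divide)
  have f_integrable: "integrable lborel (f k)" for k
    using f_integral[of k] by (simp add: has_bochner_integral_iff)
  have "(\<Sum>k. integral\<^sup>L lborel (f k)) = dirichlet_series a s / s"
    using f_integral conv unfolding dirichlet_series_def dirichlet_abs_conv_def
    by (simp add: has_bochner_integral_iff suminf_divide summable_rabs_cancel)
  then show ?thesis
    using integrable_suminf[OF f_integrable AE_I2[OF f_abs_summable] norms_summable]
      integral_suminf[OF f_integrable AE_I2[OF f_abs_summable] norms_summable]
    by (simp add: has_bochner_integral_iff sums_unique[OF f_sums, symmetric])
qed

text \<open>By Tonelli, integrate over \<open>x\<close> first. For fixed \<open>y > 0\<close> the
  substitution \<open>x = y * z\<close> separates the variables. The vanishing of \<open>A\<close>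
  and \<open>B\<close> at nonpositive arguments restricts everything to \<open>y, z > 0\<close>,
  where the laws of \<open>powr\<close> apply.\<close>

lemma nn_integral_mult_convolution:
  fixes A B :: "real \<Rightarrow> real" and r t :: real
  assumes [measurable]: "A \<in> borel_measurable borel" "B \<in> borel_measurable borel"
    and A_nonneg: "\<And>y. 0 \<le> A y" and B_nonneg: "\<And>y. 0 \<le> B y"
    and A_zero: "\<And>y. y \<le> 0 \<Longrightarrow> A y = 0" and B_zero: "\<And>y. y \<le> 0 \<Longrightarrow> B y = 0"
  shows "(\<integral>\<^sup>+ x. \<integral>\<^sup>+ y. ennreal (A y * B (x / y) * y powr (t - r - 1) * x powr (- t - 1)) \<partial>lborel \<partial>lborel)
    = (\<integral>\<^sup>+ y. ennreal (A y * y powr (- r - 1)) \<partial>lborel) * (\<integral>\<^sup>+ z. ennreal (B z * z powr (- t - 1)) \<partial>lborel)"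
proof -
  have "(\<integral>\<^sup>+ x. ennreal (A y * B (x / y) * y powr (t - r - 1) * x powr (- t - 1)) \<partial>lborel)
      = ennreal (A y * y powr (- r - 1)) * (\<integral>\<^sup>+ z. ennreal (B z * z powr (- t - 1)) \<partial>lborel)" for y
  proof (cases "y \<le> 0")
    case True
    then show ?thesis by (simp add: A_zero)
  next
    case False
    have "(\<integral>\<^sup>+ x. ennreal (A y * B (x / y) * y powr (t - r - 1) * x powr (- t - 1)) \<partial>lborel)
      = ennreal y * (\<integral>\<^sup>+ z. ennreal (A y * B z * y powr (t - r - 1) * (y * z) powr (- t - 1)) \<partial>lborel)"
      using False by (subst nn_integral_real_affine[of _ y 0]) auto
    also have "\<dots> = (\<integral>\<^sup>+ z. ennreal y * ennreal (A y * B z * y powr (t - r - 1) * (y * z) powr (- t - 1)) \<partial>lborel)"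
      by (rule nn_integral_cmult[symmetric]) measurable
    also have "\<dots> = (\<integral>\<^sup>+ z. ennreal (A y * y powr (- r - 1)) * ennreal (B z * z powr (- t - 1)) \<partial>lborel)"
    proof (rule nn_integral_cong)
      fix z :: real
      have "y * (A y * B z * y powr (t - r - 1) * (y * z) powr (- t - 1))
          = A y * y powr (- r - 1) * (B z * z powr (- t - 1))"
      proof (cases "z \<le> 0")
        case False
        \<comment> \<open>The leading \<open>y\<close> is the Jacobian of \<open>x = y * z\<close>;
          the last power comes from splitting \<open>(y * z) powr (- t - 1)\<close>.\<close>
        have "y * (y powr (t - r - 1) * y powr (- t - 1)) = y powr (1 + ((t - r - 1) + (- t - 1)))"
          using \<open>\<not> y \<le> 0\<close> by (simp only: powr_add) simp
        also have "1 + ((t - r - 1) + (- t - 1)) = - r - 1"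
          by simp
        finally have "y * (y powr (t - r - 1) * y powr (- t - 1)) = y powr (- r - 1)" .
        then show ?thesis
          using False \<open>\<not> y \<le> 0\<close> by (simp add: powr_mult ac_simps)
      qed (simp add: B_zero)
      then show "ennreal y * ennreal (A y * B z * y powr (t - r - 1) * (y * z) powr (- t - 1))
          = ennreal (A y * y powr (- r - 1)) * ennreal (B z * z powr (- t - 1))"
        using False A_nonneg B_nonneg by (simp flip: ennreal_mult)
    qed
    also have "\<dots> = ennreal (A y * y powr (- r - 1)) * (\<integral>\<^sup>+ z. ennreal (B z * z powr (- t - 1)) \<partial>lborel)"
      by (rule nn_integral_cmult) measurable
    finally show ?thesis .
  qed
  then show ?thesis
    by (subst lborel_pair.Fubini') (simp_all add: nn_integral_multc)
qed

text \<open>For \<open>y\<close> in \<open>{1..x}\<close> both \<open>y\<close> and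
  \<open>x / y\<close> are at most \<open>x\<close>, so a constant bounds the integrand. Hence the
  inner integral is a genuine value, not the default 0 of a non-integrable function.\<close>

lemma set_integrable_inner_integrand:
  "set_integrable lborel {1..x} (inner_integrand a b x)"
proof -
  define C where "C = coeff_sum (\<lambda>n. \<bar>a n\<bar>) x * coeff_sum (\<lambda>n. \<bar>b n\<bar>) x"
  have "\<bar>inner_integrand a b x y\<bar> \<le> sqrt C" if y: "y \<in> {1..x}" for y
  proof -
    have "x / y \<le> x"
      using y by (simp add: divide_le_eq mult_le_cancel_left1)
    then have "\<bar>coeff_sum a y * coeff_sum b (x / y)\<bar> \<le> C"
      unfolding C_def abs_mult using y abs_coeff_sum_le[of x x]
      by (intro mult_mono abs_coeff_sum_le) (auto intro: order_trans[OF abs_ge_zero])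
    \<comment> \<open>No sign is assumed here: \<open>sqrt\<close> is an odd function, so
      \<open>\<bar>sqrt u\<bar> = sqrt \<bar>u\<bar>\<close> also for negative
      \<open>u\<close>.\<close>
    then have "\<bar>sqrt (coeff_sum a y * coeff_sum b (x / y))\<bar> \<le> sqrt C"
      by (simp flip: real_sqrt_abs2 add: real_sqrt_abs)
    moreover have "\<bar>inner_integrand a b x y\<bar> \<le> \<bar>sqrt (coeff_sum a y * coeff_sum b (x / y))\<bar>"
      unfolding inner_integrand_def using y by (simp add: divide_le_eq mult_le_cancel_left1)
    ultimately show ?thesis by linarith
  qed
  then show ?thesis
    unfolding set_integrable_def
    by (intro integrableI_bounded_set_indicator[where B="sqrt C"])
      (auto simp: inner_integrand_def[abs_def] emeasure_lborel_Icc_eq)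
qed

lemma inner_integral_squared_le:
  assumes A_nonneg: "\<And>y. coeff_sum a y \<ge> 0" and B_nonneg: "\<And>y. coeff_sum b y \<ge> 0"
    and p: "p > 0"
  shows "ennreal ((LBINT y:{1..x}. inner_integrand a b x y)\<^sup>2)
    \<le> ennreal (1 / p) * (\<integral>\<^sup>+ y. ennreal (coeff_sum a y * coeff_sum b (x / y) * y powr (p - 1)) \<partial>lborel)"
proof -
  \<comment> \<open>The factor \<open>1 / y\<close> is shared equally: the exponents of
    \<open>f\<close> and \<open>g\<close> add up to -1. The cutoff to \<open>{1..x}\<close> goes
    into \<open>f\<close> alone, so that the square of \<open>g\<close> is the full convolution
    integrand.\<close>
  define f where "f y = indicator {1..x} y * y powr ((- p - 1) / 2)" for y :: real
  define g where "g y = sqrt (coeff_sum a y * coeff_sum b (x / y)) * y powr ((p - 1) / 2)" for y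
  have [measurable]: "f \<in> borel_measurable borel" "g \<in> borel_measurable borel"
    unfolding f_def[abs_def] g_def[abs_def] by measurable
  have f_nonneg: "0 \<le> f y" and g_nonneg: "0 \<le> g y" for y
    using A_nonneg B_nonneg by (auto simp: f_def g_def)
  have fg: "indicator {1..x} y * inner_integrand a b x y = f y * g y" for y
  proof (cases "y \<in> {1..x}")
    case True
    have "y powr ((- p - 1) / 2) * y powr ((p - 1) / 2) = y powr (- 1)"
      unfolding powr_add[symmetric] by (rule arg_cong[where f="\<lambda>e. y powr e"]) (simp add: field_simps)
    then have "y powr ((- p - 1) / 2) * y powr ((p - 1) / 2) = 1 / y"
      using True by (simp add: powr_minus_divide)
    then show ?thesis
      using True by (simp add: f_def g_def inner_integrand_def mult.left_commute)
  qed (simp add: f_def)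
  have "ennreal (LBINT y:{1..x}. inner_integrand a b x y) = (\<integral>\<^sup>+ y. ennreal (f y * g y) \<partial>lborel)"
    using set_integrable_inner_integrand[of x a b] f_nonneg g_nonneg
    unfolding set_lebesgue_integral_def set_integrable_def real_scaleR_def fg
    by (intro nn_integral_eq_integral[symmetric]) auto
  moreover have "0 \<le> (LBINT y:{1..x}. inner_integrand a b x y)"
    unfolding set_lebesgue_integral_def real_scaleR_def fg
    by (intro Bochner_Integration.integral_nonneg) (simp add: f_nonneg g_nonneg)
  ultimately have "ennreal ((LBINT y:{1..x}. inner_integrand a b x y)\<^sup>2)
      = (\<integral>\<^sup>+ y. ennreal (f y) * ennreal (g y) \<partial>lborel)\<^sup>2"
    by (simp add: ennreal_mult f_nonneg g_nonneg flip: ennreal_power)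
  also have "\<dots> \<le> (\<integral>\<^sup>+ y. (ennreal (f y))\<^sup>2 \<partial>lborel) * (\<integral>\<^sup>+ y. (ennreal (g y))\<^sup>2 \<partial>lborel)"
    by (rule Cauchy_Schwarz_nn_integral) auto
  \<comment> \<open>Enlarging \<open>{1..x}\<close> to \<open>{1..}\<close> makes the constant
    \<open>1 / p\<close> independent of \<open>x\<close>.\<close>
  also have "(\<integral>\<^sup>+ y. (ennreal (f y))\<^sup>2 \<partial>lborel) \<le> (\<integral>\<^sup>+ y. ennreal (indicator {1..} y * y powr (- p - 1)) \<partial>lborel)"
  proof (rule nn_integral_mono)
    fix y :: real
    have "(y powr ((- p - 1) / 2))\<^sup>2 = y powr (- p - 1)"
      by (simp add: power2_eq_square flip: powr_add)
    then show "(ennreal (f y))\<^sup>2 \<le> ennreal (indicator {1..} y * y powr (- p - 1))"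
      by (auto simp: f_def indicator_def ennreal_power)
  qed
  also have "\<dots> = ennreal (1 / p)"
    using has_bochner_integral_powr_atLeast[of 1 p] p
    by (subst nn_integral_eq_integral) (auto simp: has_bochner_integral_iff)
  also have "(\<lambda>y. (ennreal (g y))\<^sup>2) = (\<lambda>y. ennreal (coeff_sum a y * coeff_sum b (x / y) * y powr (p - 1)))"
  proof
    fix y :: real
    have "(y powr ((p - 1) / 2))\<^sup>2 = y powr (p - 1)"
      by (simp add: power2_eq_square flip: powr_add)
    then show "(ennreal (g y))\<^sup>2 = ennreal (coeff_sum a y * coeff_sum b (x / y) * y powr (p - 1))"
      using g_nonneg[of y] A_nonneg B_nonneg by (simp add: ennreal_power) (simp add: g_def power_mult_distrib)
  qed
  finally show ?thesis
    by (simp add: mult_right_mono)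
qed

theorem mainTheorem10:
  fixes a b :: "nat \<Rightarrow> real" and r t :: real
  assumes "\<And>y. y \<ge> 1 \<Longrightarrow> coeff_sum a y \<ge> 0"
    and "\<And>y. y \<ge> 1 \<Longrightarrow> coeff_sum b y \<ge> 0"
    and "0 < r" and "r < t"
    and "dirichlet_abs_conv a r"
    and "dirichlet_abs_conv b t"
  shows "(\<forall>x\<ge>1. set_integrable lborel {1..x} (inner_integrand a b x)) \<and>
    set_integrable lborel {1..} (outer_integrand a b t) \<and>
    (LBINT x:{1..}. outer_integrand a b t x)
      \<le> 1 / (t * (t - r) * r) * dirichlet_series a r * dirichlet_series b t"
proof -
  define p where "p = t - r"
  have p: "p > 0"
    using assms(4) by (simp add: p_def)
  have A_nonneg: "coeff_sum a y \<ge> 0" and B_nonneg: "coeff_sum b y \<ge> 0" for y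
    using assms(1,2)[of y] by (cases "y < 1"; simp add: coeff_sum_less_1)+
  define h where "h x = indicator {1..} x * outer_integrand a b t x" for x
  have h_nonneg: "0 \<le> h x" for x
    by (simp add: h_def outer_integrand_def)
  have [measurable]: "h \<in> borel_measurable borel"
  proof -
    \<comment> \<open>Moving the \<open>x\<close>-dependent interval into a condition makes the
      integrand jointly measurable in \<open>x\<close> and \<open>y\<close>, hence its integral over
      \<open>y\<close> measurable in \<open>x\<close>.\<close>
    have "(\<lambda>x. \<integral>y. (if 1 \<le> y \<and> y \<le> x then inner_integrand a b x y else 0) \<partial>lborel) \<in> borel_measurable borel"
      unfolding inner_integrand_def by measurable
    also have "(\<lambda>x. \<integral>y. (if 1 \<le> y \<and> y \<le> x then inner_integrand a b x y else 0) \<partial>lborel)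
        = (\<lambda>x. LBINT y:{1..x}. inner_integrand a b x y)"
      unfolding set_lebesgue_integral_def
      by (intro ext Bochner_Integration.integral_cong) (auto simp: indicator_def)
    finally have [measurable]: "(\<lambda>x. LBINT y:{1..x}. inner_integrand a b x y) \<in> borel_measurable borel" .
    show ?thesis
      unfolding h_def[abs_def] outer_integrand_def by measurable
  qed
  let ?conv = "\<lambda>x y. coeff_sum a y * coeff_sum b (x / y) * y powr (t - r - 1)"
  have "ennreal (h x) \<le> ennreal (1 / p) * (\<integral>\<^sup>+ y. ennreal (?conv x y * x powr (- t - 1)) \<partial>lborel)" for x
  proof (cases "x \<ge> 1")
    case True
    have "1 / x powr (t + 1) = x powr (- t - 1)"
      by (simp flip: powr_minus_divide)
    then have "h x = (LBINT y:{1..x}. inner_integrand a b x y)\<^sup>2 * x powr (- t - 1)"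
      using True by (simp add: h_def outer_integrand_def divide_inverse)
    then have "ennreal (h x) = ennreal ((LBINT y:{1..x}. inner_integrand a b x y)\<^sup>2) * ennreal (x powr (- t - 1))"
      by (simp add: ennreal_mult)
    also have "\<dots> \<le> ennreal (1 / p) * (\<integral>\<^sup>+ y. ennreal (?conv x y) \<partial>lborel) * ennreal (x powr (- t - 1))"
      using inner_integral_squared_le[OF A_nonneg B_nonneg p, of x] by (intro mult_right_mono) (simp_all add: p_def)
    also have "\<dots> = ennreal (1 / p) * (\<integral>\<^sup>+ y. ennreal (?conv x y * x powr (- t - 1)) \<partial>lborel)"
      by (subst mult.assoc, subst nn_integral_multc[symmetric])
        (simp_all add: A_nonneg B_nonneg ennreal_mult'')
    finally show ?thesis .
  qed (simp add: h_def)
  then have "(\<integral>\<^sup>+ x. ennreal (h x) \<partial>lborel)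
      \<le> (\<integral>\<^sup>+ x. ennreal (1 / p) * (\<integral>\<^sup>+ y. ennreal (?conv x y * x powr (- t - 1)) \<partial>lborel) \<partial>lborel)"
    by (intro nn_integral_mono) auto
  also have "\<dots> = ennreal (1 / p) * (\<integral>\<^sup>+ x. \<integral>\<^sup>+ y. ennreal (?conv x y * x powr (- t - 1)) \<partial>lborel \<partial>lborel)"
    by (rule nn_integral_cmult) measurable
  also have "(\<integral>\<^sup>+ x. \<integral>\<^sup>+ y. ennreal (?conv x y * x powr (- t - 1)) \<partial>lborel \<partial>lborel)
      = (\<integral>\<^sup>+ y. ennreal (coeff_sum a y * y powr (- r - 1)) \<partial>lborel) *
        (\<integral>\<^sup>+ z. ennreal (coeff_sum b z * z powr (- t - 1)) \<partial>lborel)"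
    by (rule nn_integral_mult_convolution) (auto simp: A_nonneg B_nonneg coeff_sum_less_1)
  also have "(\<integral>\<^sup>+ y. ennreal (coeff_sum a y * y powr (- r - 1)) \<partial>lborel) = ennreal (dirichlet_series a r / r)"
    using has_bochner_integral_coeff_sum[of r a] assms(3,5)
    by (subst nn_integral_eq_integral) (auto simp: has_bochner_integral_iff A_nonneg)
  also have "(\<integral>\<^sup>+ z. ennreal (coeff_sum b z * z powr (- t - 1)) \<partial>lborel) = ennreal (dirichlet_series b t / t)"
    using has_bochner_integral_coeff_sum[of t b] assms(3,4,6)
    by (subst nn_integral_eq_integral) (auto simp: has_bochner_integral_iff B_nonneg)
  finally have bound: "(\<integral>\<^sup>+ x. ennreal (h x) \<partial>lborel)
      \<le> ennreal (1 / p) * (ennreal (dirichlet_series a r / r) * ennreal (dirichlet_series b t / t))" .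
  \<comment> \<open>Signs matter because \<open>ennreal\<close> sends negative reals to 0.
    Nonnegativity is read off from the integral of the nonnegative partial sums, and then the
    product of \<open>ennreal\<close> values merges into one.\<close>
  have "0 \<le> dirichlet_series a r / r"
    using has_bochner_integral_integral_eq[OF has_bochner_integral_coeff_sum[OF assms(3,5)]]
    by (rule subst) (simp add: A_nonneg)
  moreover have "0 \<le> dirichlet_series b t / t"
    using has_bochner_integral_integral_eq[OF has_bochner_integral_coeff_sum[OF less_trans[OF assms(3,4)] assms(6)]]
    by (rule subst) (simp add: B_nonneg)
  ultimately have const_nonneg: "0 \<le> 1 / p * (dirichlet_series a r / r * (dirichlet_series b t / t))"
    and "ennreal (1 / p) * (ennreal (dirichlet_series a r / r) * ennreal (dirichlet_series b t / t))
      = ennreal (1 / p * (dirichlet_series a r / r * (dirichlet_series b t / t)))"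
    using p by (auto simp only: ennreal_mult mult_nonneg_nonneg zero_le_divide_1_iff less_imp_le)
  then have bound': "(\<integral>\<^sup>+ x. ennreal (h x) \<partial>lborel)
      \<le> ennreal (1 / p * (dirichlet_series a r / r * (dirichlet_series b t / t)))"
    using bound by (simp only:)
  \<comment> \<open>The estimate so far lives in the extended nonnegative reals; its finite bound
    now yields integrability, and only then does it transfer to the Bochner integral.\<close>
  have integrable_h: "integrable lborel h"
    using bound' h_nonneg by (intro integrableI_nonneg) (auto intro: le_less_trans)
  have "integral\<^sup>L lborel h \<le> 1 / p * (dirichlet_series a r / r * (dirichlet_series b t / t))"
    using bound' const_nonneg nn_integral_eq_integral[OF integrable_h] h_nonneg by simp
  then show ?thesis
    using integrable_h set_integrable_inner_integrand
    by (simp add: set_integrable_def set_lebesgue_integral_def p_def h_def[abs_def] ac_simps)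
qed

end
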